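(* Each strongly $\sigma$-metrizable space is $QC$-Maslyuchenko.
   Context: A regular (Hausdorff) topological space $X$ is strongly $\sigma$-metrizable if $X=\bigcup_{n\in\omega}X_n$ for an increasing sequence $(X_n)_{n\in\omega}$ of closed metrizable subspaces such that each convergent sequence in $X$ is contained in some set $X_n$. $D(f)$ denotes the set of discontinuity points of a function $f$. A subset of a topological space $X$ is meager if it is a countable union of nowhere dense subsets of $X$. A function $f:X\times Y\to Z$ is a $QC$-function if (i) for every $(x,y)\in X\times Y$ and open sets $O_x\subset X$, $O_y\subset Y$, $O\subset Z$ with $(x,y)\in O_x\times O_y$ and $f(x,y)\in O$ there is a non-empty open set $W\subset O_x$ such that $f(\{w\}\times O_y)\cap O\neq\emptyset$ for every $w\in W$; and (ii) for every $x\in X$ the function $Y\to Z$, $y\mapsto f(x,y)$, is continuous. A topological space $Z$ is $QC$-Maslyuchenko if for every topological space $X$, every second-countable space $Y$ and every $QC$-function $f:X\times Y\to Z$ the projection of $D(f)\subset X\times Y$ on $X$ is meager in $X$. *)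

theory Defs
  imports "HOL-Analysis.Analysis"
begin

text \<open>The library predicate \<open>regular_space\<close> contains no separation axiom for points,
  hence the additional \<open>Hausdorff_space\<close>.\<close>

definition strongly_sigma_metrizable :: "'a topology \<Rightarrow> bool" where
  "strongly_sigma_metrizable X \<longleftrightarrow>
     regular_space X \<and> Hausdorff_space X \<and>
     (\<exists>Xn :: nat \<Rightarrow> 'a set.
        incseq Xn \<and>
        (\<forall>n. closedin X (Xn n) \<and> metrizable_space (subtopology X (Xn n))) \<and>
        topspace X = (\<Union>n. Xn n) \<and>
        (\<forall>(s :: nat \<Rightarrow> 'a) l. range s \<subseteq> topspace X \<and> limitin X s l sequentially
            \<longrightarrow> (\<exists>n. range s \<subseteq> Xn n)))"

definition nowhere_dense_in :: "'a topology \<Rightarrow> 'a set \<Rightarrow> bool" where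
  "nowhere_dense_in X S \<longleftrightarrow> S \<subseteq> topspace X \<and> X interior_of (X closure_of S) = {}"

definition meager_in :: "'a topology \<Rightarrow> 'a set \<Rightarrow> bool" where
  "meager_in X A \<longleftrightarrow> (\<exists>S :: nat \<Rightarrow> 'a set. (\<forall>n. nowhere_dense_in X (S n)) \<and> A = (\<Union>n. S n))"

definition discontinuity_points :: "'a topology \<Rightarrow> 'b topology \<Rightarrow> ('a \<Rightarrow> 'b) \<Rightarrow> 'a set" where
  "discontinuity_points X Y f = {x \<in> topspace X. \<not> topcontinuous_at X Y f x}"

definition QC_function ::
  "'a topology \<Rightarrow> 'b topology \<Rightarrow> 'c topology \<Rightarrow> ('a \<times> 'b \<Rightarrow> 'c) \<Rightarrow> bool" where
  "QC_function X Y Z f \<longleftrightarrow>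
     f \<in> topspace X \<times> topspace Y \<rightarrow> topspace Z \<and>
     (\<forall>x y Ox Oy V.
        openin X Ox \<and> openin Y Oy \<and> openin Z V \<and>
        (x, y) \<in> Ox \<times> Oy \<and> f (x, y) \<in> V \<longrightarrow>
        (\<exists>W. openin X W \<and> W \<noteq> {} \<and> W \<subseteq> Ox \<and>
             (\<forall>w\<in>W. f ` ({w} \<times> Oy) \<inter> V \<noteq> {}))) \<and>
     (\<forall>x\<in>topspace X. continuous_map Y Z (\<lambda>y. f (x, y)))"

text \<open>HOL cannot quantify over types inside a definition, so the types carrying the test spaces
  \<open>X\<close> and \<open>Y\<close> are parameters. A theorem with these types left as type variables covers
  all topological spaces \<open>X\<close> and all second-countable spaces \<open>Y\<close>.\<close>

definition QC_Maslyuchenko :: "'x itself \<Rightarrow> 'y itself \<Rightarrow> 'z topology \<Rightarrow> bool" where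
  "QC_Maslyuchenko _ _ Z \<longleftrightarrow>
     (\<forall>(X :: 'x topology) (Y :: 'y topology) f.
        second_countable Y \<and> QC_function X Y Z f \<longrightarrow>
        meager_in X (fst ` discontinuity_points (prod_topology X Y) Z f))"

end

theory Submission
  imports Defs
begin

text \<open>
  Let \<open>Z\<close> be the increasing union of closed sets \<open>C n\<close>, metrized by \<open>d n\<close>, that swallow the
  convergent sequences, and let \<open>f\<close> be a \<open>QC\<close>-function on \<open>X \<times> Y\<close>. For a basic open set
  \<open>B\<close> of \<open>Y\<close> and \<open>e > 0\<close> let \<open>A\<close> be the set of those \<open>x\<close> for which \<open>f\<close> sends \<open>{x} \<times> B\<close> to a
  subset of \<open>C n\<close> of \<open>d n\<close>-diameter at most \<open>e\<close>. These sets capture the behaviour of \<open>f\<close> along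
  single fibres. Two facts link them to the continuity of \<open>f\<close>.

  The fibres are controlled: since \<open>Y\<close> is first countable, a continuous map from \<open>Y\<close> to \<open>Z\<close> sends
  a neighbourhood of each point into a single \<open>C n\<close>, for otherwise a convergent
  sequence in \<open>Z\<close> would leave every \<open>C n\<close> (\<open>continuous_map_locally_into_layer\<close>). So, for
  each \<open>(x, y)\<close>, a suitable \<open>n\<close> and all \<open>e\<close>, some basic \<open>B\<close> around \<open>y\<close> satisfies \<open>x \<in> A\<close>.

  Control of one fibre spreads to neighbouring fibres, for most points: let \<open>G\<close> be the union of the
  open sets \<open>W\<close> such that \<open>f\<close> sends \<open>W \<times> B\<close> to a subset of \<open>C n\<close> of diameter at most \<open>4 e\<close>.
  Then \<open>G\<close> is dense in the interior of the closure of \<open>A\<close>, so the closure of \<open>A\<close> minus \<open>G\<close>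
  is nowhere dense (\<open>nowhere_dense_unspread\<close>). The reason is that, for a
  closed set \<open>K\<close> of \<open>Z\<close>, the quasicontinuity condition makes the inclusion of \<open>f ({x} \<times> B)\<close> in \<open>K\<close>
  pass from a dense set of points \<open>x\<close> to all of them.

  Only countably many triples \<open>(B, n, e)\<close> with \<open>e = 1 / Suc m\<close> matter, so the union of the
  exceptional sets is meager. If \<open>x\<close> lies in none of them, then the products \<open>W \<times> B\<close>
  witness the continuity of \<open>f\<close> at every point \<open>(x, y)\<close>.
\<close>

section \<open>Meager sets\<close>

lemma nowhere_dense_in_subset:
  assumes "nowhere_dense_in X S" "T \<subseteq> S"
  shows "nowhere_dense_in X T"
  using assms interior_of_mono[OF closure_of_mono[OF \<open>T \<subseteq> S\<close>, of X], of X]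
  unfolding nowhere_dense_in_def by blast

lemma meager_in_countable_cover:
  assumes "countable I" "\<And>i. i \<in> I \<Longrightarrow> nowhere_dense_in X (N i)" "A \<subseteq> (\<Union>i\<in>I. N i)"
  shows "meager_in X A"
proof (cases "I = {}")
  case True
  with assms(3) have "A = (\<Union>n::nat. {})" by simp
  moreover have "nowhere_dense_in X {}" by (simp add: nowhere_dense_in_def)
  ultimately show ?thesis
    unfolding meager_in_def by (intro exI[of _ "\<lambda>_. {}"]) simp
next
  case False
  have "nowhere_dense_in X (A \<inter> N (from_nat_into I k))" for k
    using assms(2)[OF from_nat_into[OF False]] by (rule nowhere_dense_in_subset) blast
  moreover have "A = (\<Union>k. A \<inter> N (from_nat_into I k))"
  proof (intro equalityI subsetI)
    fix x assume "x \<in> A"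
    then obtain i where "i \<in> I" "x \<in> N i" using assms(3) by blast
    moreover from this obtain k where "from_nat_into I k = i"
      using from_nat_into_surj[OF assms(1)] by blast
    ultimately show "x \<in> (\<Union>k. A \<inter> N (from_nat_into I k))"
      using \<open>x \<in> A\<close> by blast
  qed blast
  ultimately show ?thesis
    unfolding meager_in_def by (intro exI[of _ "\<lambda>k. A \<inter> N (from_nat_into I k)"]) simp
qed

section \<open>Continuous maps into an exhausted space\<close>

lemma first_countable_decreasing_base:
  assumes "first_countable Y" "y \<in> topspace Y"
  obtains U :: "nat \<Rightarrow> 'a set" where "\<And>k. openin Y (U k)" "\<And>k. y \<in> U k"
    "\<And>V. openin Y V \<Longrightarrow> y \<in> V \<Longrightarrow> \<exists>k. \<forall>j\<ge>k. U j \<subseteq> V"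
proof -
  obtain \<B> where \<B>: "countable \<B>" "\<And>B. B \<in> \<B> \<Longrightarrow> openin Y B"
    and base: "\<And>V. openin Y V \<Longrightarrow> y \<in> V \<Longrightarrow> \<exists>B\<in>\<B>. y \<in> B \<and> B \<subseteq> V"
    using assms unfolding first_countable_def by metis
  define \<N> where "\<N> = {B \<in> \<B>. y \<in> B}"
  have "countable \<N>"
    using \<B>(1) by (simp add: \<N>_def)
  moreover have ne: "\<N> \<noteq> {}"
    using base[OF openin_topspace assms(2)] by (auto simp: \<N>_def)
  ultimately have range: "range (from_nat_into \<N>) = \<N>" by simp
  define U where "U k = (\<Inter>j\<le>k. from_nat_into \<N> j)" for k
  have mem: "from_nat_into \<N> j \<in> \<N>" for j
    by (rule from_nat_into[OF ne])
  show thesis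
  proof
    show "openin Y (U k)" for k
      unfolding U_def using mem \<B>(2) by (intro openin_Inter) (auto simp: \<N>_def)
    show "y \<in> U k" for k
      using mem by (auto simp: U_def \<N>_def)
    show "\<exists>k. \<forall>j\<ge>k. U j \<subseteq> V" if V: "openin Y V" "y \<in> V" for V
    proof -
      obtain B where B: "B \<in> \<N>" "B \<subseteq> V"
        using base[OF V] by (auto simp: \<N>_def)
      then obtain k where "B = from_nat_into \<N> k"
        using range by blast
      with B(2) show ?thesis
        by (auto simp: U_def)
    qed
  qed
qed

text \<open>If the image of every neighbourhood left every layer, then choosing in the \<open>k\<close>-th
  neighbourhood a point mapped outside \<open>C k\<close> would give a convergent sequence of values that
  is contained in no layer.\<close>

lemma continuous_map_locally_into_layer:
  fixes C :: "nat \<Rightarrow> 'b set"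
  assumes "first_countable Y" "y \<in> topspace Y" and g: "continuous_map Y Z g"
    and swallow: "\<And>s l. range s \<subseteq> topspace Z \<Longrightarrow> limitin Z s l sequentially \<Longrightarrow>
                    \<exists>n. range s \<subseteq> C n"
  shows "\<exists>U n. openin Y U \<and> y \<in> U \<and> g ` U \<subseteq> C n"
proof (rule ccontr)
  assume "\<not> ?thesis"
  then have leaves: "\<not> g ` U \<subseteq> C n" if "openin Y U" "y \<in> U" for U n
    using that by blast
  obtain U :: "nat \<Rightarrow> 'a set" where U: "\<And>k. openin Y (U k)" "\<And>k. y \<in> U k"
    and small: "\<And>V. openin Y V \<Longrightarrow> y \<in> V \<Longrightarrow> \<exists>k. \<forall>j\<ge>k. U j \<subseteq> V"
    using first_countable_decreasing_base[OF assms(1,2)] by metis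
  have "\<exists>t. t \<in> U k \<and> g t \<notin> C k" for k
    using leaves[OF U, of k k] by blast
  then obtain t where t: "\<And>k. t k \<in> U k" "\<And>k. g (t k) \<notin> C k"
    by metis
  have "limitin Y t y sequentially"
    unfolding limitin_sequentially
  proof (intro conjI allI impI)
    show "\<exists>k. \<forall>j\<ge>k. t j \<in> V" if "openin Y V \<and> y \<in> V" for V
      using small[of V] that t(1) by blast
  qed (fact assms(2))
  then have "limitin Z (g \<circ> t) (g y) sequentially"
    by (rule continuous_map_limit[OF g])
  moreover have "range (g \<circ> t) \<subseteq> topspace Z"
    using t(1) U(1) continuous_map_image_subset_topspace[OF g] openin_subset by fastforce
  ultimately obtain n where "range (g \<circ> t) \<subseteq> C n"
    using swallow by blast
  then show False
    using t(2)[of n] by auto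
qed

section \<open>Spreading control from single fibres to open sets of fibres\<close>

text \<open>Otherwise some fibre over \<open>W\<close> meets the open complement of \<open>K\<close>, hence so do
  all fibres over some non-empty open subset of \<open>W\<close>, and such a subset contains a point of \<open>A\<close>.\<close>

lemma QC_function_closed_image_from_dense:
  assumes QC: "QC_function X Y Z f" and W: "openin X W" "W \<subseteq> X closure_of A"
    and B: "openin Y B" and K: "closedin Z K"
    and dense: "\<And>a. a \<in> A \<inter> W \<Longrightarrow> f ` ({a} \<times> B) \<subseteq> K"
  shows "f ` (W \<times> B) \<subseteq> K"
proof (rule ccontr)
  assume "\<not> ?thesis"
  then obtain w y where wy: "w \<in> W" "y \<in> B" "f (w, y) \<notin> K"
    by blast
  have "f (w, y) \<in> topspace Z - K"
    using QC wy openin_subset[OF W(1)] openin_subset[OF B] by (auto simp: QC_function_def)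
  moreover have "openin Z (topspace Z - K)"
    using K by blast
  ultimately obtain W' where W': "openin X W'" "W' \<noteq> {}" "W' \<subseteq> W"
    and meets: "\<And>w. w \<in> W' \<Longrightarrow> f ` ({w} \<times> B) \<inter> (topspace Z - K) \<noteq> {}"
    using QC W(1) B wy unfolding QC_function_def by (metis mem_Sigma_iff)
  have "W' \<inter> A \<noteq> {}"
    using W' W(2) openin_Int_closure_of_eq_empty[OF W'(1), of A] by blast
  then show False
    using meets dense W'(3) by blast
qed

text \<open>The set \<open>R\<close> will be a fibre \<open>{x} \<times> B\<close> or a box \<open>W \<times> B\<close>. Bounding pairwise distances instead
  of a supremum lets the empty \<open>R\<close> count as small.\<close>

definition small_on :: "('p \<Rightarrow> 'c) \<Rightarrow> 'c set \<Rightarrow> ('c \<Rightarrow> 'c \<Rightarrow> real) \<Rightarrow> real \<Rightarrow> 'p set \<Rightarrow> bool" where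
  "small_on f C d e R \<longleftrightarrow> f ` R \<subseteq> C \<and> (\<forall>p\<in>R. \<forall>q\<in>R. d (f p) (f q) \<le> e)"

definition small_fibres ::
  "'a topology \<Rightarrow> ('a \<times> 'b \<Rightarrow> 'c) \<Rightarrow> 'b set \<Rightarrow> 'c set \<Rightarrow> ('c \<Rightarrow> 'c \<Rightarrow> real) \<Rightarrow> real \<Rightarrow> 'a set" where
  "small_fibres X f B C d e = {x \<in> topspace X. small_on f C d e ({x} \<times> B)}"

definition small_boxes ::
  "'a topology \<Rightarrow> ('a \<times> 'b \<Rightarrow> 'c) \<Rightarrow> 'b set \<Rightarrow> 'c set \<Rightarrow> ('c \<Rightarrow> 'c \<Rightarrow> real) \<Rightarrow> real \<Rightarrow> 'a set" where
  "small_boxes X f B C d e = \<Union>{W. openin X W \<and> small_on f C d e (W \<times> B)}"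

lemma small_on_mono: "small_on f C d e R \<Longrightarrow> e \<le> e' \<Longrightarrow> small_on f C d e' R"
  unfolding small_on_def by (meson order_trans)

lemma small_boxes_mono: "e \<le> e' \<Longrightarrow> small_boxes X f B C d e \<subseteq> small_boxes X f B C d e'"
  unfolding small_boxes_def by (rule Union_mono) (auto intro: small_on_mono)

text \<open>Every non-empty open subset \<open>U\<close> of the closure of the small fibres contains a
  non-empty open \<open>W\<close> with \<open>W \<times> B\<close> small. Indeed, density puts
  \<open>f (U \<times> B)\<close> into the closed set \<open>C\<close>. For a value \<open>z\<close> of \<open>f\<close> on \<open>U \<times> B\<close>, quasicontinuity
  gives a \<open>W\<close> over which every fibre takes a value within \<open>e\<close> of \<open>z\<close>, so the small fibres
  over \<open>W\<close> are mapped into the closed ball of radius \<open>2 e\<close> around \<open>z\<close>, and by density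
  so are all the others.\<close>

lemma nowhere_dense_unspread:
  assumes QC: "QC_function X Y Z f" and B: "openin Y B"
    and C: "closedin Z C" and M: "Metric_space C d"
    and top: "subtopology Z C = Metric_space.mtopology C d" and "e > 0"
  shows "nowhere_dense_in X
           (X closure_of small_fibres X f B C d e - small_boxes X f B C d (4 * e))"
    (is "nowhere_dense_in X (X closure_of ?A - ?G)")
proof -
  interpret Metric_space C d by (fact M)
  have "openin X ?G"
    unfolding small_boxes_def by (rule openin_Union) blast
  then have closed: "closedin X (X closure_of ?A - ?G)"
    by (intro closedin_diff closedin_closure_of)
  have "X interior_of (X closure_of ?A - ?G) = {}"
    unfolding interior_of_eq_empty
  proof (intro allI impI, rule ccontr)
    fix U assume U: "openin X U \<and> U \<subseteq> X closure_of ?A - ?G" and "U \<noteq> {}"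
    then obtain x where x: "x \<in> U" by blast
    have UA: "U \<subseteq> X closure_of ?A"
      using U by blast
    have "\<exists>W. openin X W \<and> W \<noteq> {} \<and> W \<subseteq> U \<and> small_on f C d (4 * e) (W \<times> B)"
    proof (cases "B = {}")
      case True
      then show ?thesis using U \<open>U \<noteq> {}\<close> by (auto simp: small_on_def)
    next
      case False
      then obtain y where y: "y \<in> B" by blast
      have UC: "f ` (U \<times> B) \<subseteq> C"
      proof (rule QC_function_closed_image_from_dense[OF QC _ UA B C])
        show "openin X U" using U by blast
        show "f ` ({a} \<times> B) \<subseteq> C" if "a \<in> ?A \<inter> U" for a
          using that by (simp add: small_fibres_def small_on_def)
      qed
      define z where "z = f (x, y)"
      have z: "z \<in> C"
        using UC x y by (auto simp: z_def)
      obtain V where V: "openin Z V" "mball z e = V \<inter> C"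
        using openin_mball[of z e] unfolding top[symmetric] openin_subtopology by blast
      then have "f (x, y) \<in> V"
        using z \<open>e > 0\<close> unfolding z_def by (metis Int_iff centre_in_mball_iff)
      then obtain W where W: "openin X W" "W \<noteq> {}" "W \<subseteq> U"
        and meets: "\<And>w. w \<in> W \<Longrightarrow> f ` ({w} \<times> B) \<inter> V \<noteq> {}"
        using QC U B V(1) x y unfolding QC_function_def by (metis mem_Sigma_iff)
      have K: "closedin Z (mcball z (2 * e))"
        using closedin_mcball[of z "2 * e"] C unfolding top[symmetric]
        by (rule closedin_trans_full)
      have "f ` (W \<times> B) \<subseteq> mcball z (2 * e)"
      proof (rule QC_function_closed_image_from_dense[OF QC W(1) _ B K])
        show "W \<subseteq> X closure_of ?A"
          using W(3) UA by blast
        fix a assume a: "a \<in> ?A \<inter> W"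
        then obtain y' where y': "y' \<in> B" "f (a, y') \<in> V"
          using meets[of a] by auto
        have aC: "f (a, t) \<in> C" if "t \<in> B" for t
          using that a W(3) UC by blast
        have near: "d z (f (a, y')) < e"
          using V(2) y' aC by (metis Int_iff in_mball)
        show "f ` ({a} \<times> B) \<subseteq> mcball z (2 * e)"
        proof clarify
          fix t assume t: "t \<in> B"
          have "d (f (a, y')) (f (a, t)) \<le> e"
            using a t y'(1) by (auto simp: small_fibres_def small_on_def)
          then have "d z (f (a, t)) \<le> 2 * e"
            using near triangle[OF z aC[OF y'(1)] aC[OF t]] by linarith
          then show "f (a, t) \<in> mcball z (2 * e)"
            using z aC[OF t] by simp
        qed
      qed
      then have ball: "f p \<in> C" "d z (f p) \<le> 2 * e" if "p \<in> W \<times> B" for p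
        using that by (auto dest!: subsetD)
      have "d (f p) (f q) \<le> 4 * e" if "p \<in> W \<times> B" "q \<in> W \<times> B" for p q
        using triangle[of "f p" z "f q"] ball[OF that(1)] ball[OF that(2)] z
        by (simp add: commute)
      then have "small_on f C d (4 * e) (W \<times> B)"
        using ball(1) unfolding small_on_def by blast
      with W show ?thesis by blast
    qed
    then show False
      using U unfolding small_boxes_def by blast
  qed
  moreover have "X closure_of (X closure_of ?A - ?G) = X closure_of ?A - ?G"
    using closed by (simp add: closure_of_eq)
  ultimately show ?thesis
    using closedin_subset[OF closed] by (simp add: nowhere_dense_in_def)
qed

section \<open>Continuity outside the exceptional sets\<close>

text \<open>This is where the two parts of smallness work together: the layer \<open>C\<close>, fixed while \<open>e\<close>
  varies, carries the subspace topology of \<open>Z\<close>, so small \<open>d\<close>-diameter inside \<open>C\<close> keeps the values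
  in a given neighbourhood in \<open>Z\<close>.\<close>

lemma topcontinuous_at_of_small_boxes:
  assumes f: "f \<in> topspace X \<times> topspace Y \<rightarrow> topspace Z"
    and M: "Metric_space C d" and top: "subtopology Z C = Metric_space.mtopology C d"
    and boxes: "\<And>e. e > 0 \<Longrightarrow> \<exists>B. openin Y B \<and> y \<in> B \<and> x \<in> small_boxes X f B C d e"
  shows "topcontinuous_at (prod_topology X Y) Z f (x, y)"
proof -
  interpret Metric_space C d by (fact M)
  have box: "\<exists>W B. openin X W \<and> openin Y B \<and> (x, y) \<in> W \<times> B \<and> small_on f C d e (W \<times> B)"
    if "e > 0" for e
    using boxes[OF that] unfolding small_boxes_def by auto
  obtain W B where WB: "openin X W" "openin Y B" "(x, y) \<in> W \<times> B" "small_on f C d 1 (W \<times> B)"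
    using box[of 1] by auto
  have mem: "(x, y) \<in> topspace X \<times> topspace Y"
    using WB(3) openin_subset[OF WB(1)] openin_subset[OF WB(2)] by auto
  have C: "f (x, y) \<in> C"
    using WB(3,4) by (auto simp: small_on_def)
  have "\<exists>U. openin (prod_topology X Y) U \<and> (x, y) \<in> U \<and> (\<forall>p\<in>U. f p \<in> V)"
    if V: "openin Z V" "f (x, y) \<in> V" for V
  proof -
    have "openin mtopology (V \<inter> C)"
      unfolding top[symmetric] openin_subtopology using V(1) by blast
    then obtain r where r: "r > 0" "mball (f (x, y)) r \<subseteq> V \<inter> C"
      using V(2) C unfolding openin_mtopology by blast
    obtain W B where WB: "openin X W" "openin Y B" "(x, y) \<in> W \<times> B"
      and small: "small_on f C d (r / 2) (W \<times> B)"
      using box[of "r / 2"] r(1) by auto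
    have "f p \<in> V" if "p \<in> W \<times> B" for p
    proof -
      have "f p \<in> C" "d (f (x, y)) (f p) \<le> r / 2"
        using that WB(3) small by (auto simp: small_on_def)
      then have "f p \<in> mball (f (x, y)) r"
        using C r(1) by simp
      with r(2) show ?thesis by blast
    qed
    with WB show ?thesis
      by (intro exI[of _ "W \<times> B"]) (simp add: openin_prod_Times_iff)
  qed
  with f mem show ?thesis
    unfolding topcontinuous_at_def by (simp add: topspace_prod_topology)
qed

text \<open>The neighbourhood is found in two steps: first inside an open set that the fibre map sends
  into \<open>C\<close>, then inside the preimage of a ball of radius \<open>e / 2\<close>.\<close>

lemma continuous_map_small_on_base:
  assumes g: "continuous_map Y Z g" and U: "openin Y U" "y \<in> U" "g ` U \<subseteq> C"
    and M: "Metric_space C d" and top: "subtopology Z C = Metric_space.mtopology C d" and "e > 0"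
    and base: "\<And>V. openin Y V \<Longrightarrow> y \<in> V \<Longrightarrow> \<exists>B\<in>\<B>. y \<in> B \<and> B \<subseteq> V"
  shows "\<exists>B\<in>\<B>. y \<in> B \<and> small_on g C d e B"
proof -
  interpret Metric_space C d by (fact M)
  have C: "g y \<in> C" using U by blast
  obtain V where V: "openin Z V" "mball (g y) (e / 2) = V \<inter> C"
    using openin_mball[of "g y" "e / 2"] unfolding top[symmetric] openin_subtopology by blast
  have "openin Y (U \<inter> {t \<in> topspace Y. g t \<in> V})"
    using openin_Int[OF U(1) openin_continuous_map_preimage[OF g V(1)]] .
  moreover have "g y \<in> mball (g y) (e / 2)"
    using C \<open>e > 0\<close> by simp
  then have "y \<in> U \<inter> {t \<in> topspace Y. g t \<in> V}"
    using V(2) U(2) openin_subset[OF U(1)] by blast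
  ultimately obtain B where B: "B \<in> \<B>" "y \<in> B" "B \<subseteq> U \<inter> {t \<in> topspace Y. g t \<in> V}"
    using base by meson
  have ball: "g t \<in> mball (g y) (e / 2)" if "t \<in> B" for t
    using that B(3) U(3) V(2) by blast
  have "d (g s) (g t) \<le> e" if "s \<in> B" "t \<in> B" for s t
    using ball[OF that(1)] ball[OF that(2)] triangle[of "g s" "g y" "g t"]
    by (simp add: commute)
  then have "small_on g C d e B"
    using ball by (auto simp: small_on_def)
  with B show ?thesis by blast
qed

theorem corollary3p9:
  fixes Z :: "'z topology"
  assumes "strongly_sigma_metrizable Z"
  shows "QC_Maslyuchenko TYPE('x) TYPE('y) Z"
  unfolding QC_Maslyuchenko_def
proof (intro allI impI)
  fix X :: "'x topology" and Y :: "'y topology" and f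
  assume *: "second_countable Y \<and> QC_function X Y Z f"
  then have QC: "QC_function X Y Z f" and fc: "first_countable Y"
    using second_countable_imp_first_countable by blast+
  obtain \<B> where \<B>: "countable \<B>" "\<And>B. B \<in> \<B> \<Longrightarrow> openin Y B"
    and base: "\<And>V y. openin Y V \<Longrightarrow> y \<in> V \<Longrightarrow> \<exists>B\<in>\<B>. y \<in> B \<and> B \<subseteq> V"
    using * unfolding second_countable_def by meson
  obtain C :: "nat \<Rightarrow> 'z set"
    where C: "\<And>n. closedin Z (C n)" "\<And>n. metrizable_space (subtopology Z (C n))"
      and swallow: "\<And>s l. range s \<subseteq> topspace Z \<Longrightarrow> limitin Z s l sequentially \<Longrightarrow>
                      \<exists>n. range s \<subseteq> C n"
    using assms unfolding strongly_sigma_metrizable_def by metis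
  have "\<exists>d. Metric_space (C n) d \<and> subtopology Z (C n) = Metric_space.mtopology (C n) d" for n
  proof -
    obtain M d where Md: "Metric_space M d" "subtopology Z (C n) = Metric_space.mtopology M d"
      using C(2) unfolding metrizable_space_def by blast
    moreover have "M = C n"
      using Metric_space.topspace_mtopology[OF Md(1)] closedin_subset[OF C(1)] Md(2)
      by (metis topspace_subtopology_subset)
    ultimately show ?thesis by blast
  qed
  then obtain d where M: "\<And>n. Metric_space (C n) (d n)"
    and top: "\<And>n. subtopology Z (C n) = Metric_space.mtopology (C n) (d n)"
    by metis
  define N where "N = (\<lambda>(B, n, m :: nat).
    X closure_of small_fibres X f B (C n) (d n) (1 / Suc m)
      - small_boxes X f B (C n) (d n) (4 * (1 / Suc m)))"
  show "meager_in X (fst ` discontinuity_points (prod_topology X Y) Z f)"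
  proof (rule meager_in_countable_cover)
    show "countable (\<B> \<times> (UNIV :: (nat \<times> nat) set))"
      using \<B>(1) by simp
    show "nowhere_dense_in X (N i)" if i_mem: "i \<in> \<B> \<times> UNIV" for i
    proof -
      obtain B n m where i: "i = (B, n, m)" "B \<in> \<B>"
        using i_mem by (cases i) auto
      show ?thesis
        using nowhere_dense_unspread[OF QC \<B>(2)[OF i(2)] C(1) M top, of "1 / Suc m" n]
        by (simp add: N_def i(1))
    qed
    show "fst ` discontinuity_points (prod_topology X Y) Z f \<subseteq> (\<Union>i\<in>\<B> \<times> UNIV. N i)"
    proof (rule ccontr)
      assume "\<not> ?thesis"
      then obtain x y where xy: "x \<in> topspace X" "y \<in> topspace Y"
        and disc: "\<not> topcontinuous_at (prod_topology X Y) Z f (x, y)"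
        and notin: "x \<notin> (\<Union>i\<in>\<B> \<times> UNIV. N i)"
        by (fastforce simp: discontinuity_points_def)
      then have avoid: "x \<notin> N (B, n, m)" if "B \<in> \<B>" for B n m
        using that by blast
      have cont: "continuous_map Y Z (\<lambda>y. f (x, y))"
        using QC xy(1) by (simp add: QC_function_def)
      obtain U n where U: "openin Y U" "y \<in> U" "(\<lambda>y. f (x, y)) ` U \<subseteq> C n"
      proof -
        have "\<exists>U n. openin Y U \<and> y \<in> U \<and> (\<lambda>y. f (x, y)) ` U \<subseteq> C n"
          by (rule continuous_map_locally_into_layer[OF fc xy(2) cont]) (rule swallow)
        with that show thesis by meson
      qed
      \<comment> \<open>The layer \<open>n\<close> depends on \<open>(x, y)\<close> alone, while \<open>B\<close> shrinks with \<open>e\<close>.\<close>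
      have "\<exists>B. openin Y B \<and> y \<in> B \<and> x \<in> small_boxes X f B (C n) (d n) e" if "e > 0" for e
      proof -
        have "0 < e / 4"
          using that by simp
        then obtain m where m: "1 / Suc m < e / 4"
          by (rule nat_approx_posE)
        obtain B where B: "B \<in> \<B>" "y \<in> B"
          and small: "small_on (\<lambda>y. f (x, y)) (C n) (d n) (1 / Suc m) B"
        proof -
          have "\<exists>B\<in>\<B>. y \<in> B \<and> small_on (\<lambda>y. f (x, y)) (C n) (d n) (1 / Suc m) B"
            by (rule continuous_map_small_on_base[OF cont U M top]) (simp, rule base)
          with that show thesis by meson
        qed
        have "x \<in> small_fibres X f B (C n) (d n) (1 / Suc m)"
          using small xy(1) by (auto simp: small_fibres_def small_on_def)
        then have "x \<in> X closure_of small_fibres X f B (C n) (d n) (1 / Suc m)"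
          using xy(1) by (auto simp: in_closure_of)
        then have "x \<in> small_boxes X f B (C n) (d n) (4 * (1 / Suc m))"
          using avoid[OF B(1), of n m] by (simp add: N_def)
        moreover have "4 * (1 / Suc m) \<le> e"
          using m by linarith
        ultimately have "x \<in> small_boxes X f B (C n) (d n) e"
          by (rule subsetD[OF small_boxes_mono, rotated])
        with B \<B>(2) show ?thesis by blast
      qed
      then have "topcontinuous_at (prod_topology X Y) Z f (x, y)"
        using QC by (intro topcontinuous_at_of_small_boxes[OF _ M top])
          (auto simp: QC_function_def)
      with disc show False ..
    qed
  qed
qed

end
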